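(* Let $u\in V$ be a unit vector, let $\hat u\in\hat V=\operatorname{Im}\mathbb O$ denote the corresponding unit imaginary octonion, and let $Q\in\mathbb R$. Then the operator $H_{u,Q}=h-Q\,R_{\hat u}$ on $W=\mathbb O\otimes_{\mathbb R}V$ is $\mathrm{SU}(3)$-equivariant with respect to the diagonal action on $W$ of the stabilizer $\mathrm{SU}(3)\subset G_2$ of $u$.
   Context: $\mathbb O$ is the octonion algebra. $V$ is an oriented Euclidean $7$-dimensional real vector space with a fixed isometric identification $V\cong\hat V:=\operatorname{Im}\mathbb O$, $v\mapsto\hat v$; only hatted vectors are multiplied. $G_2=\operatorname{Aut}(\mathbb O)$ acts on $\operatorname{Im}\mathbb O$ and, via the identification, on $V$; it acts diagonally on $W$ by $\gamma\cdot(x\otimes v)=\gamma(x)\otimes\gamma(v)$. The stabilizer of a unit vector $u\in V$ (equivalently of $\hat u$) in $G_2$ is isomorphic to $\mathrm{SU}(3)$. Fix an orthonormal basis $e_1,\dots,e_7$ of $V$ with corresponding basis $\hat e_i$ of $\hat V$; repeated indices are summed. The operator $h:W\to W$ (independent of the basis) is $h(\hat w)=\big((\hat e_i\hat e_j)\hat w_j\big)\otimes e_i$ for $\hat w=\hat w_j\otimes e_j$. Right multiplication on $W$ is $R_a(x\otimes v)=(xa)\otimes v$. *)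

theory Defs
  imports "HOL-Analysis.Analysis" "HOL-Analysis.Finite_Function_Topology"
begin

section \<open>The octonion algebra\<close>

text \<open>
  The octonions are \<open>\<real> \<oplus> \<real>\<^sup>7\<close>.  The seven imaginary units are indexed by the type \<open>7\<close>, that is
  by the integers modulo 7, and multiply by the Fano plane rule
  \<open>\<epsilon>\<^sub>i \<epsilon>\<^sub>i\<^sub>+\<^sub>1 = \<epsilon>\<^sub>i\<^sub>+\<^sub>3\<close> (and its cyclic permutations), indices being taken modulo 7.
\<close>

definition cross7 :: "real ^ 7 \<Rightarrow> real ^ 7 \<Rightarrow> real ^ 7" where
  "cross7 x y = (\<chi> k.
      (x $ (k + 1) * y $ (k + 3) - x $ (k + 3) * y $ (k + 1))
    + (x $ (k + 2) * y $ (k + 6) - x $ (k + 6) * y $ (k + 2))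
    + (x $ (k + 4) * y $ (k + 5) - x $ (k + 5) * y $ (k + 4)))"

typedef octo = "UNIV :: (real \<times> (real ^ 7)) set" ..

setup_lifting type_definition_octo

lift_definition Octo :: "real \<Rightarrow> real ^ 7 \<Rightarrow> octo" is Pair .
lift_definition octo_Re :: "octo \<Rightarrow> real" is fst .
lift_definition octo_Im :: "octo \<Rightarrow> real ^ 7" is snd .

instantiation octo :: real_inner
begin

lift_definition zero_octo :: octo is 0 .
lift_definition plus_octo :: "octo \<Rightarrow> octo \<Rightarrow> octo" is "(+)" .
lift_definition minus_octo :: "octo \<Rightarrow> octo \<Rightarrow> octo" is "(-)" .
lift_definition uminus_octo :: "octo \<Rightarrow> octo" is uminus .
lift_definition scaleR_octo :: "real \<Rightarrow> octo \<Rightarrow> octo" is scaleR .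
lift_definition inner_octo :: "octo \<Rightarrow> octo \<Rightarrow> real" is inner .
lift_definition norm_octo :: "octo \<Rightarrow> real" is norm .
lift_definition dist_octo :: "octo \<Rightarrow> octo \<Rightarrow> real" is dist .
lift_definition sgn_octo :: "octo \<Rightarrow> octo" is sgn .

definition uniformity_octo :: "(octo \<times> octo) filter" where
  "uniformity_octo = (INF e\<in>{0<..}. principal {(x, y). dist x y < e})"

definition open_octo :: "octo set \<Rightarrow> bool" where
  "open_octo U \<longleftrightarrow> (\<forall>x\<in>U. \<forall>\<^sub>F (x', y) in uniformity. x' = x \<longrightarrow> y \<in> U)"

instance
proof
  show "uniformity = (INF e\<in>{0<..}. principal {(x :: octo, y). dist x y < e})"
    by (rule uniformity_octo_def)
  show "open U = (\<forall>x\<in>U. \<forall>\<^sub>F (x', y) in uniformity. x' = x \<longrightarrow> y \<in> U)" for U :: "octo set"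
    by (rule open_octo_def)
qed (transfer; simp add: algebra_simps inner_commute inner_add_right dist_norm sgn_div_norm
       norm_eq_sqrt_inner)+

end

instantiation octo :: "{one, times}"
begin

definition one_octo :: octo where
  "1 = Octo 1 0"

definition times_octo :: "octo \<Rightarrow> octo \<Rightarrow> octo" where
  "x * y = Octo
     (octo_Re x * octo_Re y - octo_Im x \<bullet> octo_Im y)
     (octo_Re x *\<^sub>R octo_Im y + octo_Re y *\<^sub>R octo_Im x + cross7 (octo_Im x) (octo_Im y))"

instance ..

end

lemma sum_7: "sum f (UNIV :: 7 set) = f 0 + f 1 + f 2 + f 3 + f 4 + f 5 + f 6"
  for f :: "7 \<Rightarrow> real"
proof -
  have "card {0, 1, 2, 3, 4, 5, 6 :: 7} = CARD(7)"
    by (simp add: card_insert_if)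
  then have UNIV_7: "UNIV = {0, 1, 2, 3, 4, 5, 6 :: 7}"
    by (metis card_subset_eq finite subset_UNIV)
  show ?thesis
    unfolding UNIV_7 by (simp add: add.assoc)
qed

lemma numeral_mod_7:
  "7 = (0 :: 7)" "8 = (1 :: 7)" "9 = (2 :: 7)" "10 = (3 :: 7)" "11 = (4 :: 7)" "12 = (5 :: 7)"
  by simp_all

lemma
  shows inner_cross7_left: "x \<bullet> cross7 x y = 0"
    and inner_cross7_right: "y \<bullet> cross7 x y = 0"
    and inner_cross7_cross7:
      "cross7 x y \<bullet> cross7 x y = (x \<bullet> x) * (y \<bullet> y) - (x \<bullet> y) * (x \<bullet> y)"
  by (simp_all add: inner_vec_def sum_7 cross7_def numeral_mod_7 algebra_simps)

lemma inner_octo: "x \<bullet> y = octo_Re x * octo_Re y + octo_Im x \<bullet> octo_Im y"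
  by transfer (simp add: inner_prod_def)

lemma octo_sel [simp]: "octo_Re (Octo a b) = a" "octo_Im (Octo a b) = b"
  by (transfer; simp)+

text \<open>With this product the octonions form an 8-dimensional composition algebra.\<close>

lemma octo_norm_mult: "norm (x * y) = norm x * norm y" for x y :: octo
proof -
  have "(x * y) \<bullet> (x * y) = (x \<bullet> x) * (y \<bullet> y)"
    by (simp add: inner_octo times_octo_def inner_add_left inner_add_right inner_cross7_left
        inner_cross7_right inner_cross7_cross7 inner_cross7_left[THEN trans[OF inner_commute]]
        inner_cross7_right[THEN trans[OF inner_commute]]
        inner_commute[of "octo_Im y" "octo_Im x"] algebra_simps)
  then show ?thesis
    by (simp add: norm_eq_sqrt_inner real_sqrt_mult)
qed

definition Im_octo :: "octo set" where
  "Im_octo = {x. octo_Re x = 0}"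


section \<open>The tensor product of real vector spaces\<close>

text \<open>
  The quotient of the free vector space on \<open>'a \<times> 'b\<close> by the subspace spanned by the
  bilinearity relations.
\<close>

definition tensor_relations ::
    "('a::real_vector \<times> 'b::real_vector, real) poly_mapping set" where
  "tensor_relations =
     (let g = (\<lambda>x v. Poly_Mapping.single (x, v) (1 :: real)) in
        {g (x + y) v - (g x v + g y v) | x y v. True}
      \<union> {g x (v + w) - (g x v + g x w) | x v w. True}
      \<union> {g (r *\<^sub>R x) v - r *\<^sub>R g x v | r x v. True}
      \<union> {g x (r *\<^sub>R v) - r *\<^sub>R g x v | r x v. True})"

definition tensor_eq ::
    "('a::real_vector \<times> 'b::real_vector, real) poly_mapping \<Rightarrow> ('a \<times> 'b, real) poly_mapping \<Rightarrow> bool" where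
  "tensor_eq f g \<longleftrightarrow> f - g \<in> span tensor_relations"

lemma equivp_tensor_eq: "equivp tensor_eq"
proof (rule equivpI)
  show "reflp tensor_eq"
    by (simp add: reflp_def tensor_eq_def span_zero)
  show "symp tensor_eq"
    unfolding symp_def tensor_eq_def using span_neg by fastforce
  show "transp tensor_eq"
    unfolding transp_def tensor_eq_def using span_add by fastforce
qed

quotient_type (overloaded) ('a, 'b) tensor =
  "('a::real_vector \<times> 'b::real_vector, real) poly_mapping" / tensor_eq
  by (rule equivp_tensor_eq)

lemma tensor_eq_add: "tensor_eq f f' \<Longrightarrow> tensor_eq g g' \<Longrightarrow> tensor_eq (f + g) (f' + g')"
  unfolding tensor_eq_def
  by (drule (1) span_add) (simp add: algebra_simps)

lemma tensor_eq_scale: "tensor_eq f f' \<Longrightarrow> tensor_eq (r *\<^sub>R f) (r *\<^sub>R f')"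
  unfolding tensor_eq_def
  by (drule span_scale[where c = r]) (simp add: algebra_simps)

instantiation tensor :: (real_vector, real_vector) real_vector
begin

lift_definition zero_tensor :: "('a, 'b) tensor" is 0 .

lift_definition plus_tensor :: "('a, 'b) tensor \<Rightarrow> ('a, 'b) tensor \<Rightarrow> ('a, 'b) tensor" is "(+)"
  by (rule tensor_eq_add)

lift_definition uminus_tensor :: "('a, 'b) tensor \<Rightarrow> ('a, 'b) tensor" is uminus
  using tensor_eq_scale[of _ _ "-1"] by simp

lift_definition minus_tensor :: "('a, 'b) tensor \<Rightarrow> ('a, 'b) tensor \<Rightarrow> ('a, 'b) tensor" is "(-)"
  using tensor_eq_add tensor_eq_scale[of _ _ "-1"] by fastforce

lift_definition scaleR_tensor :: "real \<Rightarrow> ('a, 'b) tensor \<Rightarrow> ('a, 'b) tensor" is scaleR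
  by (rule tensor_eq_scale)

instance
  by standard (transfer; simp add: tensor_eq_def span_zero algebra_simps)+

end

lift_definition tensor :: "'a::real_vector \<Rightarrow> 'b::real_vector \<Rightarrow> ('a, 'b) tensor"
    (infixl "\<otimes>\<^sub>R" 76) is "\<lambda>x v. Poly_Mapping.single (x, v) 1" .

lemma bilinear_tensor: "bilinear (\<otimes>\<^sub>R)"
proof -
  note rels = tensor_relations_def Let_def tensor_eq_def
  have "(x + y) \<otimes>\<^sub>R v = x \<otimes>\<^sub>R v + y \<otimes>\<^sub>R v" for x y :: 'a and v :: 'b
    by transfer (unfold rels, rule span_base, blast)
  moreover have "x \<otimes>\<^sub>R (v + w) = x \<otimes>\<^sub>R v + x \<otimes>\<^sub>R w" for x :: 'a and v w :: 'b
    by transfer (unfold rels, rule span_base, blast)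
  moreover have "(r *\<^sub>R x) \<otimes>\<^sub>R v = r *\<^sub>R (x \<otimes>\<^sub>R v)" for r and x :: 'a and v :: 'b
    by transfer (unfold rels, rule span_base, blast)
  moreover have "x \<otimes>\<^sub>R (r *\<^sub>R v) = r *\<^sub>R (x \<otimes>\<^sub>R v)" for r and x :: 'a and v :: 'b
    by transfer (unfold rels, rule span_base, blast)
  ultimately show ?thesis
    by (simp add: bilinear_def linear_iff)
qed

text \<open>The linear map on the tensor product induced by a bilinear map.\<close>

definition tensor_lift ::
    "('a::real_vector \<Rightarrow> 'b::real_vector \<Rightarrow> 'c::real_vector) \<Rightarrow> ('a, 'b) tensor \<Rightarrow> 'c" where
  "tensor_lift f = (THE F. linear F \<and> (\<forall>x v. F (x \<otimes>\<^sub>R v) = f x v))"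

lemma span_tensors: "span {x \<otimes>\<^sub>R v | x v. True} = (UNIV :: ('a::real_vector, 'b::real_vector) tensor set)"
proof -
  let ?T = "{x \<otimes>\<^sub>R v | x v. True} :: ('a, 'b) tensor set"
  have *: "abs_tensor f \<in> span ?T" for f :: "('a \<times> 'b, real) poly_mapping"
  proof (induction f rule: update_induct)
    case const
    then show ?case by (metis span_zero zero_tensor.abs_eq)
  next
    case (update f p r)
    obtain x v where p: "p = (x, v)" by (cases p)
    have "Poly_Mapping.update p r f = f + r *\<^sub>R Poly_Mapping.single p 1"
      using update by (intro poly_mapping_eqI)
        (auto simp: lookup_update lookup_add lookup_single scaleR_poly_mapping_def
          in_keys_iff Abs_poly_mapping_inverse when_def)
    then have "abs_tensor (Poly_Mapping.update p r f) = abs_tensor f + r *\<^sub>R (x \<otimes>\<^sub>R v)"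
      by (simp add: p plus_tensor.abs_eq scaleR_tensor.abs_eq tensor.abs_eq)
    then show ?case
      using update by (metis (mono_tags, lifting) span_add span_scale span_base mem_Collect_eq)
  qed
  show ?thesis
  proof (intro UNIV_eq_I[THEN sym])
    show "w \<in> span ?T" for w
      by (induction w rule: tensor.abs_induct) (rule *)
  qed
qed

lemma tensor_lift_unique:
  fixes F G :: "('a::real_vector, 'b::real_vector) tensor \<Rightarrow> 'c::real_vector"
  assumes "linear F" "linear G" "\<And>x v. F (x \<otimes>\<^sub>R v) = G (x \<otimes>\<^sub>R v)"
  shows "F = G"
proof (rule ext)
  fix w :: "('a, 'b) tensor"
  have "w \<in> span {x \<otimes>\<^sub>R v | x v. True}"
    using span_tensors by (metis UNIV_I)
  then show "F w = G w"
    by (rule linear_eq_on[OF assms(1,2)]) (use assms(3) in blast)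
qed

lemma tensor_lift_exists:
  fixes f :: "'a::real_vector \<Rightarrow> 'b::real_vector \<Rightarrow> 'c::real_vector"
  assumes f: "bilinear f"
  shows "\<exists>F. linear F \<and> (\<forall>x v. F (x \<otimes>\<^sub>R v) = f x v)"
proof -
  define E :: "('a \<times> 'b, real) poly_mapping \<Rightarrow> 'c" where
    "E p = (\<Sum>(x, v)\<in>Poly_Mapping.keys p. Poly_Mapping.lookup p (x, v) *\<^sub>R f x v)" for p
  have E_alt: "E p = (\<Sum>(x, v)\<in>S. Poly_Mapping.lookup p (x, v) *\<^sub>R f x v)"
    if "finite S" "Poly_Mapping.keys p \<subseteq> S" for p S
    unfolding E_def using that by (intro sum.mono_neutral_left) (auto simp: in_keys_iff)
  have lookup_scale: "Poly_Mapping.lookup (r *\<^sub>R p) z = r * Poly_Mapping.lookup p z"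
    for r and p :: "('a \<times> 'b, real) poly_mapping" and z
    by (simp add: scaleR_poly_mapping_def)
  have lin_E: "linear E"
  proof (rule linearI)
    fix p q :: "('a \<times> 'b, real) poly_mapping"
    let ?S = "Poly_Mapping.keys p \<union> Poly_Mapping.keys q"
    have "E (p + q) = (\<Sum>(x, v)\<in>?S. Poly_Mapping.lookup (p + q) (x, v) *\<^sub>R f x v)"
      by (rule E_alt) (auto simp: keys_add)
    also have "\<dots> = (\<Sum>(x, v)\<in>?S. Poly_Mapping.lookup p (x, v) *\<^sub>R f x v)
        + (\<Sum>(x, v)\<in>?S. Poly_Mapping.lookup q (x, v) *\<^sub>R f x v)"
      by (simp add: lookup_add scaleR_add_left sum.distrib case_prod_unfold)
    also have "\<dots> = E p + E q"
      by (subst (1 2) E_alt[of ?S]) auto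
    finally show "E (p + q) = E p + E q" .
  next
    fix r :: real and p :: "('a \<times> 'b, real) poly_mapping"
    have "E (r *\<^sub>R p) = (\<Sum>(x, v)\<in>Poly_Mapping.keys p. Poly_Mapping.lookup (r *\<^sub>R p) (x, v) *\<^sub>R f x v)"
      by (rule E_alt) (auto simp: in_keys_iff lookup_scale)
    then show "E (r *\<^sub>R p) = r *\<^sub>R E p"
      by (simp add: E_def lookup_scale scaleR_sum_right case_prod_unfold)
  qed
  have E_single: "E (Poly_Mapping.single (x, v) 1) = f x v" for x v
    by (simp add: E_def)
  have E_rel: "E p = 0" if "p \<in> tensor_relations" for p
    using that unfolding tensor_relations_def Let_def
    by (auto simp: linear_diff[OF lin_E] linear_add[OF lin_E] linear_scale[OF lin_E] E_single
        bilinear_ladd[OF f] bilinear_radd[OF f] bilinear_lmul[OF f] bilinear_rmul[OF f])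
  have E_span: "E p = 0" if "p \<in> span tensor_relations" for p
    using linear_eq_0_on_span[OF lin_E E_rel that] .
  have E_cong: "E p = E q" if "tensor_eq p q" for p q
    using E_span[of "p - q"] that by (simp add: tensor_eq_def linear_diff[OF lin_E])
  define F where "F w = E (rep_tensor w)" for w
  have F_abs: "F (abs_tensor p) = E p" for p
    unfolding F_def by (rule E_cong) (metis Quotient3_tensor rep_abs_rsp_left Quotient3_def equivp_reflp equivp_tensor_eq)
  have "linear F"
  proof (rule linearI)
    show "F (w + z) = F w + F z" for w z
      by (induction w rule: tensor.abs_induct, induction z rule: tensor.abs_induct)
        (simp add: plus_tensor.abs_eq F_abs linear_add[OF lin_E])
    show "F (r *\<^sub>R w) = r *\<^sub>R F w" for r w
      by (induction w rule: tensor.abs_induct)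
        (simp add: scaleR_tensor.abs_eq F_abs linear_scale[OF lin_E])
  qed
  moreover have "F (x \<otimes>\<^sub>R v) = f x v" for x v
    by (simp add: tensor.abs_eq F_abs E_single)
  ultimately show ?thesis by blast
qed

lemma tensor_lift:
  assumes "bilinear f"
  shows linear_tensor_lift: "linear (tensor_lift f)"
    and tensor_lift_tensor: "tensor_lift f (x \<otimes>\<^sub>R v) = f x v"
proof -
  have "\<exists>!F. linear F \<and> (\<forall>x v. F (x \<otimes>\<^sub>R v) = f x v)"
    using tensor_lift_exists[OF assms] tensor_lift_unique by (metis (no_types, lifting))
  from theI'[OF this] show "linear (tensor_lift f)" "tensor_lift f (x \<otimes>\<^sub>R v) = f x v"
    unfolding tensor_lift_def by blast+
qed


section \<open>The space \<open>W\<close> and its operators\<close>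

type_synonym 'v W = "(octo, 'v) tensor"

text \<open>
  Throughout, \<open>\<phi>\<close> is the isometric identification of \<open>V\<close> with the imaginary octonions, so that
  \<open>\<phi> v\<close> is the hatted vector of \<open>v\<close>.
\<close>

definition isometric_identification :: "('v::euclidean_space \<Rightarrow> octo) \<Rightarrow> bool" where
  "isometric_identification \<phi> \<longleftrightarrow>
     linear \<phi> \<and> (\<forall>v. norm (\<phi> v) = norm v) \<and> range \<phi> = Im_octo"

definition orthonormal_basis :: "(7 \<Rightarrow> 'v::euclidean_space) \<Rightarrow> bool" where
  "orthonormal_basis e \<longleftrightarrow>
     (\<forall>i j. e i \<bullet> e j = (if i = j then 1 else 0)) \<and> span (range e) = UNIV"

definition tensor_components :: "(7 \<Rightarrow> 'v::euclidean_space) \<Rightarrow> 'v W \<Rightarrow> 7 \<Rightarrow> octo" where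
  "tensor_components e w = (THE c. w = (\<Sum>j\<in>UNIV. c j \<otimes>\<^sub>R e j))"

lemma orthonormal_expansion:
  assumes "orthonormal_basis e"
  shows "(\<Sum>j\<in>UNIV. (v \<bullet> e j) *\<^sub>R e j) = v"
proof -
  have "linear (\<lambda>v. \<Sum>j\<in>UNIV. (v \<bullet> e j) *\<^sub>R e j)"
    by (intro linearI)
      (simp_all add: inner_add_left scaleR_add_left sum.distrib scaleR_sum_right)
  moreover have "(\<Sum>j\<in>UNIV. (e k \<bullet> e j) *\<^sub>R e j) = e k" for k
  proof -
    have "(e k \<bullet> e j) *\<^sub>R e j = (if j = k then e j else 0)" for j
      using assms by (simp add: orthonormal_basis_def)
    then show ?thesis by simp
  qed
  moreover have "v \<in> span (range e)"
    using assms by (simp add: orthonormal_basis_def)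
  ultimately show ?thesis
    by (intro linear_eq_on[of _ "\<lambda>v. v" v "range e"]) (auto intro: linear_id[unfolded id_def])
qed

lemma tensor_expansion_unique:
  assumes e: "orthonormal_basis e"
    and eq: "(\<Sum>j\<in>UNIV. c j \<otimes>\<^sub>R e j) = (\<Sum>j\<in>UNIV. d j \<otimes>\<^sub>R e j)"
  shows "c = d"
proof
  fix k
  let ?K = "tensor_lift (\<lambda>x v. (v \<bullet> e k) *\<^sub>R x)"
  have bil: "bilinear (\<lambda>(x :: 'b) v. (v \<bullet> e k) *\<^sub>R x)"
    by (simp add: bilinear_def linear_iff inner_add_left algebra_simps)
  have "?K (\<Sum>j\<in>UNIV. b j \<otimes>\<^sub>R e j) = b k" for b :: "7 \<Rightarrow> 'b"
  proof -
    have "(e j \<bullet> e k) *\<^sub>R b j = (if j = k then b j else 0)" for j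
      using e by (simp add: orthonormal_basis_def)
    then show ?thesis
      by (simp add: linear_sum[OF linear_tensor_lift[OF bil]] tensor_lift_tensor[OF bil])
  qed
  then show "c k = d k"
    using eq by metis
qed

lemma tensor_expansion_exists:
  fixes w :: "('a::real_vector, 'b::euclidean_space) tensor"
  assumes e: "orthonormal_basis e"
  shows "\<exists>c. w = (\<Sum>j\<in>UNIV. c j \<otimes>\<^sub>R e j)"
proof -
  have "w \<in> span {x \<otimes>\<^sub>R v | x v. True}"
    using span_tensors by (metis UNIV_I)
  then show ?thesis
  proof (induction rule: span_induct_alt)
    case base
    have "(0 :: 'a) \<otimes>\<^sub>R v = 0" for v :: 'b
      by (rule bilinear_lzero[OF bilinear_tensor])
    then show ?case by (intro exI[of _ "\<lambda>_. 0"]) simp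
  next
    case (step r t w)
    then obtain x v c where t: "t = x \<otimes>\<^sub>R v" and c: "w = (\<Sum>j\<in>UNIV. c j \<otimes>\<^sub>R e j)"
      by auto
    have "t = x \<otimes>\<^sub>R (\<Sum>j\<in>UNIV. (v \<bullet> e j) *\<^sub>R e j)"
      by (simp add: t orthonormal_expansion[OF e])
    also have "\<dots> = (\<Sum>j\<in>UNIV. ((v \<bullet> e j) *\<^sub>R x) \<otimes>\<^sub>R e j)"
      using bilinear_tensor[where 'a = 'a and 'b = 'b]
      by (simp add: bilinear_def linear_sum[of "(\<otimes>\<^sub>R) x"] bilinear_lmul[OF bilinear_tensor]
          bilinear_rmul[OF bilinear_tensor])
    finally have "r *\<^sub>R t + w = (\<Sum>j\<in>UNIV. (r *\<^sub>R (v \<bullet> e j) *\<^sub>R x + c j) \<otimes>\<^sub>R e j)"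
      by (simp only: c bilinear_ladd[OF bilinear_tensor] bilinear_lmul[OF bilinear_tensor]
          scaleR_sum_right sum.distrib)
    then show ?case by (intro exI)
  qed
qed

lemma tensor_components:
  assumes "orthonormal_basis e"
  shows "tensor_components e (\<Sum>j\<in>UNIV. c j \<otimes>\<^sub>R e j) = c"
  unfolding tensor_components_def
  using tensor_expansion_unique[OF assms] by (intro the_equality) auto

definition h_op :: "('v::euclidean_space \<Rightarrow> octo) \<Rightarrow> (7 \<Rightarrow> 'v) \<Rightarrow> 'v W \<Rightarrow> 'v W" where
  "h_op \<phi> e w =
     (\<Sum>i\<in>UNIV. (\<Sum>j\<in>UNIV. (\<phi> (e i) * \<phi> (e j)) * tensor_components e w j) \<otimes>\<^sub>R e i)"

lemma h_op:
  assumes "orthonormal_basis e"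
  shows "h_op \<phi> e (\<Sum>j\<in>UNIV. w j \<otimes>\<^sub>R e j) =
    (\<Sum>i\<in>UNIV. (\<Sum>j\<in>UNIV. (\<phi> (e i) * \<phi> (e j)) * w j) \<otimes>\<^sub>R e i)"
  by (simp add: h_op_def tensor_components[OF assms])

definition R_op :: "octo \<Rightarrow> 'v::euclidean_space W \<Rightarrow> 'v W" where
  "R_op a = tensor_lift (\<lambda>x v. (x * a) \<otimes>\<^sub>R v)"

lemma bilinear_octo_times: "bilinear (\<lambda>x y :: octo. x * y)"
proof -
  have eqI: "x = y" if "octo_Re x = octo_Re y" "octo_Im x = octo_Im y" for x y
    using that by transfer (simp add: prod_eq_iff)
  have sel: "octo_Re (x + y) = octo_Re x + octo_Re y" "octo_Im (x + y) = octo_Im x + octo_Im y"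
    "octo_Re (r *\<^sub>R x) = r * octo_Re x" "octo_Im (r *\<^sub>R x) = r *\<^sub>R octo_Im x" for x y r
    by (transfer; simp)+
  show ?thesis
    unfolding bilinear_def linear_iff times_octo_def
    by (auto intro!: eqI simp: sel inner_add_left inner_add_right cross7_def vec_eq_iff
        algebra_simps)
qed

lemma R_op: "R_op a (x \<otimes>\<^sub>R v) = (x * a) \<otimes>\<^sub>R v"
  unfolding R_op_def
  by (rule tensor_lift_tensor)
    (simp add: bilinear_def linear_iff bilinear_ladd[OF bilinear_tensor]
      bilinear_radd[OF bilinear_tensor] bilinear_lmul[OF bilinear_tensor]
      bilinear_rmul[OF bilinear_tensor] bilinear_ladd[OF bilinear_octo_times]
      bilinear_lmul[OF bilinear_octo_times])

definition H_op ::
    "('v::euclidean_space \<Rightarrow> octo) \<Rightarrow> (7 \<Rightarrow> 'v) \<Rightarrow> 'v \<Rightarrow> real \<Rightarrow> 'v W \<Rightarrow> 'v W" where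
  "H_op \<phi> e u Q w = h_op \<phi> e w - Q *\<^sub>R R_op (\<phi> u) w"

definition G2 :: "(octo \<Rightarrow> octo) set" where
  "G2 = {\<gamma>. linear \<gamma> \<and> bij \<gamma> \<and> (\<forall>x y. \<gamma> (x * y) = \<gamma> x * \<gamma> y)}"

definition V_act :: "('v::euclidean_space \<Rightarrow> octo) \<Rightarrow> (octo \<Rightarrow> octo) \<Rightarrow> 'v \<Rightarrow> 'v" where
  "V_act \<phi> \<gamma> v = inv \<phi> (\<gamma> (\<phi> v))"

definition W_act :: "('v::euclidean_space \<Rightarrow> octo) \<Rightarrow> (octo \<Rightarrow> octo) \<Rightarrow> 'v W \<Rightarrow> 'v W" where
  "W_act \<phi> \<gamma> = tensor_lift (\<lambda>x v. \<gamma> x \<otimes>\<^sub>R V_act \<phi> \<gamma> v)"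

text \<open>The copy of \<open>SU(3)\<close> in \<open>G\<^sub>2\<close> determined by a unit vector \<open>u\<close>.\<close>

definition stabilizer :: "('v::euclidean_space \<Rightarrow> octo) \<Rightarrow> 'v \<Rightarrow> (octo \<Rightarrow> octo) set" where
  "stabilizer \<phi> u = {\<gamma> \<in> G2. V_act \<phi> \<gamma> u = u}"

definition equivariant :: "'g set \<Rightarrow> ('g \<Rightarrow> 'w \<Rightarrow> 'w) \<Rightarrow> ('w \<Rightarrow> 'w) \<Rightarrow> bool" where
  "equivariant G act T \<longleftrightarrow> (\<forall>\<gamma>\<in>G. \<forall>w. T (act \<gamma> w) = act \<gamma> (T w))"

end

theory Submission
  imports Defs
begin

text \<open>
  An automorphism \<open>\<gamma>\<close> of the octonions carries every ingredient of the formula for \<open>h\<close> in an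
  orthonormal basis \<open>e\<close> to the corresponding ingredient in the basis \<open>\<gamma> e\<close>, so conjugation by
  \<open>\<gamma>\<close> turns \<open>h\<close> written in \<open>e\<close> into \<open>h\<close> written in \<open>\<gamma> e\<close>.  Two facts are needed to see that this
  is again \<open>h\<close>.

  First, \<open>\<gamma> e\<close> is an orthonormal basis of \<open>V\<close>.  As \<open>G2\<close> is defined by the product alone, both the
  invariance of the imaginary octonions and that of the norm have to be extracted from the
  product.  This is done by squares: \<open>\<gamma>\<close> fixes \<open>1\<close>, and for \<open>r \<ge> 0\<close>, \<open>x\<close> is imaginary of norm
  \<open>r\<close> exactly if \<open>x * x = - r\<^sup>2\<close> (\<open>G2_Re_norm\<close>, \<open>orthonormal_basis_V_act\<close>).

  Second, \<open>h\<close> does not depend on the orthonormal basis.  On a pure tensor, \<open>h (x \<otimes> v)\<close> is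
  \<open>\<Sum>\<^sub>i B (e\<^sub>i, e\<^sub>i)\<close> for the bilinear map \<open>B (a, b) = ((a v) x) \<otimes> b\<close>, and such a trace is the same in
  all orthonormal bases (\<open>orthonormal_trace_unique\<close>, \<open>h_op_basis_independent\<close>).

  Hence \<open>h\<close> commutes with all of \<open>G2\<close>.  For right multiplication by \<open>u\<close> one has
  \<open>\<gamma> (x u) = \<gamma> x \<gamma> u\<close>, and here the stabilizer enters: \<open>\<gamma> u = u\<close>.
\<close>

section \<open>The operator \<open>h\<close> without coordinates\<close>

lemmas tensor_bilinear_simps =
  bilinear_ladd[OF bilinear_tensor] bilinear_radd[OF bilinear_tensor]
  bilinear_lmul[OF bilinear_tensor] bilinear_rmul[OF bilinear_tensor]

lemmas octo_bilinear_simps =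
  bilinear_ladd[OF bilinear_octo_times] bilinear_radd[OF bilinear_octo_times]
  bilinear_lmul[OF bilinear_octo_times] bilinear_rmul[OF bilinear_octo_times]

lemma linear_R_op: "linear (R_op a)"
  unfolding R_op_def
  by (rule linear_tensor_lift)
    (simp add: bilinear_def linear_iff tensor_bilinear_simps octo_bilinear_simps)

lemma bilinear_h_op:
  fixes \<phi> :: "'v::real_vector \<Rightarrow> octo"
  assumes "linear \<phi>"
  shows "bilinear (\<lambda>x v. \<Sum>i\<in>UNIV. ((\<phi> (e i) * \<phi> v) * x) \<otimes>\<^sub>R e i)"
  by (simp add: bilinear_def linear_iff linear_add[OF assms] linear_scale[OF assms]
      tensor_bilinear_simps octo_bilinear_simps sum.distrib scaleR_sum_right)

text \<open>
  The components of a tensor enter \<open>h_op\<close> as a definite description.  Rewriting \<open>h_op\<close> as an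
  induced map removes them: linearity is then immediate, and identities for \<open>h_op\<close> need only be
  checked on pure tensors.
\<close>

lemma h_op_eq_tensor_lift:
  fixes \<phi> :: "'v::euclidean_space \<Rightarrow> octo"
  assumes \<phi>: "linear \<phi>" and e: "orthonormal_basis e"
  shows "h_op \<phi> e = tensor_lift (\<lambda>x v. \<Sum>i\<in>UNIV. ((\<phi> (e i) * \<phi> v) * x) \<otimes>\<^sub>R e i)"
proof
  fix w :: "'v W"
  note B = bilinear_h_op[OF \<phi>, of e]
  obtain c where c: "w = (\<Sum>j\<in>UNIV. c j \<otimes>\<^sub>R e j)"
    using tensor_expansion_exists[OF e] by blast
  have "h_op \<phi> e w = (\<Sum>i\<in>UNIV. \<Sum>j\<in>UNIV. ((\<phi> (e i) * \<phi> (e j)) * c j) \<otimes>\<^sub>R e i)"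
  proof -
    have lin: "linear (\<lambda>x :: octo. x \<otimes>\<^sub>R e i)" for i
      using bilinear_tensor[where 'a = octo and 'b = 'v] by (simp add: bilinear_def)
    show ?thesis
      unfolding c h_op[OF e] by (simp add: linear_sum[OF lin])
  qed
  also have "\<dots> = (\<Sum>j\<in>UNIV. \<Sum>i\<in>UNIV. ((\<phi> (e i) * \<phi> (e j)) * c j) \<otimes>\<^sub>R e i)"
    by (rule sum.swap)
  also have "\<dots> = tensor_lift (\<lambda>x v. \<Sum>i\<in>UNIV. ((\<phi> (e i) * \<phi> v) * x) \<otimes>\<^sub>R e i) w"
    by (simp add: c linear_sum[OF linear_tensor_lift[OF B]] tensor_lift_tensor[OF B])
  finally show "h_op \<phi> e w = \<dots>" .
qed

lemma linear_h_op:
  assumes "linear \<phi>" "orthonormal_basis e"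
  shows "linear (h_op \<phi> e)"
  unfolding h_op_eq_tensor_lift[OF assms]
  by (rule linear_tensor_lift[OF bilinear_h_op[OF assms(1)]])

lemma h_op_tensor:
  assumes "linear \<phi>" "orthonormal_basis e"
  shows "h_op \<phi> e (x \<otimes>\<^sub>R v) = (\<Sum>i\<in>UNIV. ((\<phi> (e i) * \<phi> v) * x) \<otimes>\<^sub>R e i)"
  unfolding h_op_eq_tensor_lift[OF assms]
  by (rule tensor_lift_tensor[OF bilinear_h_op[OF assms(1)]])

text \<open>
  Expand one argument in the other basis, \<open>e\<^sub>i = \<Sum>\<^sub>k (e\<^sub>i \<bullet> f\<^sub>k) f\<^sub>k\<close>; the coefficients then reassemble
  the other argument, \<open>\<Sum>\<^sub>i (f\<^sub>k \<bullet> e\<^sub>i) e\<^sub>i = f\<^sub>k\<close>.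
\<close>

lemma orthonormal_trace_unique:
  assumes B: "bilinear B" and e: "orthonormal_basis e" and f: "orthonormal_basis f"
  shows "(\<Sum>i\<in>UNIV. B (e i) (e i)) = (\<Sum>k\<in>UNIV. B (f k) (f k))"
proof -
  have lin: "linear (B a)" "linear (\<lambda>a. B a b)" for a b
    using B by (auto simp: bilinear_def)
  have "(\<Sum>i\<in>UNIV. B (e i) (e i)) = (\<Sum>i\<in>UNIV. B (e i) (\<Sum>k\<in>UNIV. (e i \<bullet> f k) *\<^sub>R f k))"
    by (simp add: orthonormal_expansion[OF f])
  also have "\<dots> = (\<Sum>i\<in>UNIV. \<Sum>k\<in>UNIV. (e i \<bullet> f k) *\<^sub>R B (e i) (f k))"
    by (simp add: linear_sum[OF lin(1)] linear_scale[OF lin(1)])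
  also have "\<dots> = (\<Sum>k\<in>UNIV. \<Sum>i\<in>UNIV. (f k \<bullet> e i) *\<^sub>R B (e i) (f k))"
    by (subst sum.swap) (simp add: inner_commute)
  also have "\<dots> = (\<Sum>k\<in>UNIV. B (\<Sum>i\<in>UNIV. (f k \<bullet> e i) *\<^sub>R e i) (f k))"
    by (simp add: linear_sum[OF lin(2)] linear_scale[OF lin(2)])
  also have "\<dots> = (\<Sum>k\<in>UNIV. B (f k) (f k))"
    by (simp add: orthonormal_expansion[OF e])
  finally show ?thesis .
qed

lemma h_op_basis_independent:
  assumes \<phi>: "linear \<phi>" and e: "orthonormal_basis e" and f: "orthonormal_basis f"
  shows "h_op \<phi> e = h_op \<phi> f"
proof (rule tensor_lift_unique)
  show "linear (h_op \<phi> e)" "linear (h_op \<phi> f)"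
    using linear_h_op[OF \<phi>] e f by blast+
  fix x v
  have "bilinear (\<lambda>a b. ((\<phi> a * \<phi> v) * x) \<otimes>\<^sub>R b)"
    by (simp add: bilinear_def linear_iff linear_add[OF \<phi>] linear_scale[OF \<phi>]
        tensor_bilinear_simps octo_bilinear_simps)
  from orthonormal_trace_unique[OF this e f]
  show "h_op \<phi> e (x \<otimes>\<^sub>R v) = h_op \<phi> f (x \<otimes>\<^sub>R v)"
    by (simp add: h_op_tensor[OF \<phi> e] h_op_tensor[OF \<phi> f])
qed

section \<open>Automorphisms of the octonions act by isometries\<close>

lemma octo_eq_iff: "x = y \<longleftrightarrow> octo_Re x = octo_Re y \<and> octo_Im x = octo_Im y"
  by transfer (simp add: prod_eq_iff)

lemma octo_mult_one: "1 * x = x" "x * 1 = x" for x :: octo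
  by (simp_all add: octo_eq_iff one_octo_def times_octo_def cross7_def vec_eq_iff)

lemma octo_linear_sel:
  "octo_Re (- x) = - octo_Re x" "octo_Im (- x) = - octo_Im x"
  "octo_Re (r *\<^sub>R x) = r * octo_Re x" "octo_Im (r *\<^sub>R x) = r *\<^sub>R octo_Im x"
  by (transfer; simp)+

lemma octo_square_sel:
  "octo_Re (x * x) = (octo_Re x)\<^sup>2 - (norm (octo_Im x))\<^sup>2"
  "octo_Im (x * x) = (2 * octo_Re x) *\<^sub>R octo_Im x"
  by (simp_all add: times_octo_def power2_eq_square power2_norm_eq_inner[symmetric]
      cross7_def vec_eq_iff)

lemma octo_norm_square: "(norm x)\<^sup>2 = (octo_Re x)\<^sup>2 + (norm (octo_Im x))\<^sup>2"
  by (simp add: power2_norm_eq_inner inner_octo) (simp add: power2_eq_square)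

text \<open>
  The imaginary part of \<open>x * x\<close> is \<open>2 Re x Im x\<close>, so an octonion with real square is either
  imaginary or real, and the square of a nonzero real is positive.
\<close>

lemma imaginary_iff_square:
  "octo_Re x = 0 \<and> norm x = r \<longleftrightarrow> 0 \<le> r \<and> x * x = (- r\<^sup>2) *\<^sub>R 1"
proof
  assume x: "octo_Re x = 0 \<and> norm x = r"
  then have "r\<^sup>2 = (norm (octo_Im x))\<^sup>2"
    using octo_norm_square[of x] by simp
  then show "0 \<le> r \<and> x * x = (- r\<^sup>2) *\<^sub>R 1"
    using x by (auto simp: octo_eq_iff octo_square_sel octo_linear_sel one_octo_def)
next
  assume *: "0 \<le> r \<and> x * x = (- r\<^sup>2) *\<^sub>R 1"
  then have eqs: "(octo_Re x)\<^sup>2 - (norm (octo_Im x))\<^sup>2 = - r\<^sup>2" "octo_Re x *\<^sub>R octo_Im x = 0"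
    by (auto simp: octo_eq_iff octo_square_sel octo_linear_sel one_octo_def)
  have Re: "octo_Re x = 0"
  proof (rule ccontr)
    assume "octo_Re x \<noteq> 0"
    then have "octo_Im x = 0"
      using eqs(2) by simp
    then have "(octo_Re x)\<^sup>2 + r\<^sup>2 = 0"
      using eqs(1) by simp
    then show False
      using \<open>octo_Re x \<noteq> 0\<close> by (simp add: sum_power2_eq_zero_iff)
  qed
  then have "(norm x)\<^sup>2 = r\<^sup>2"
    using eqs(1) octo_norm_square[of x] by simp
  then show "octo_Re x = 0 \<and> norm x = r"
    using Re * by simp
qed

lemma G2_one:
  assumes "\<gamma> \<in> G2"
  shows "\<gamma> 1 = 1"
proof -
  obtain y where y: "\<gamma> y = 1"
    using assms unfolding G2_def by (metis (mono_tags, lifting) mem_Collect_eq bij_pointE)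
  have "\<gamma> (1 * y) = \<gamma> 1 * \<gamma> y"
    using assms by (simp only: G2_def mem_Collect_eq)
  then show ?thesis
    by (simp add: y octo_mult_one)
qed

lemma G2_Re_norm:
  assumes \<gamma>: "\<gamma> \<in> G2" and x: "octo_Re x = 0"
  shows "octo_Re (\<gamma> x) = 0 \<and> norm (\<gamma> x) = norm x"
proof -
  have lin: "linear \<gamma>" and mult: "\<gamma> (x * x) = \<gamma> x * \<gamma> x"
    using \<gamma> by (simp_all add: G2_def)
  have "x * x = (- (norm x)\<^sup>2) *\<^sub>R 1"
    using x imaginary_iff_square by blast
  then have "\<gamma> x * \<gamma> x = (- (norm x)\<^sup>2) *\<^sub>R 1"
    by (metis mult linear_scale[OF lin] G2_one[OF \<gamma>])
  then show ?thesis
    using imaginary_iff_square norm_ge_zero by blast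
qed

lemma isometric_identification_V_act:
  assumes \<phi>: "isometric_identification \<phi>" and \<gamma>: "\<gamma> \<in> G2"
  shows "\<phi> (V_act \<phi> \<gamma> v) = \<gamma> (\<phi> v)"
proof -
  have range: "range \<phi> = {x. octo_Re x = 0}"
    using \<phi> by (simp add: isometric_identification_def Im_octo_def)
  then have "octo_Re (\<phi> v) = 0"
    by blast
  then have "\<gamma> (\<phi> v) \<in> range \<phi>"
    using range G2_Re_norm[OF \<gamma>] by blast
  then show ?thesis
    unfolding V_act_def by (rule f_inv_into_f)
qed

lemma norm_V_act:
  assumes \<phi>: "isometric_identification \<phi>" and \<gamma>: "\<gamma> \<in> G2"
  shows "norm (V_act \<phi> \<gamma> v) = norm v"
proof -
  have "octo_Re (\<phi> v) = 0"
    using \<phi> by (auto simp: isometric_identification_def Im_octo_def)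
  then have "norm (\<phi> (V_act \<phi> \<gamma> v)) = norm (\<phi> v)"
    using G2_Re_norm[OF \<gamma>] isometric_identification_V_act[OF \<phi> \<gamma>] by simp
  then show ?thesis
    using \<phi> by (simp add: isometric_identification_def)
qed

lemma linear_V_act:
  assumes \<phi>: "isometric_identification \<phi>" and \<gamma>: "\<gamma> \<in> G2"
  shows "linear (V_act \<phi> \<gamma>)"
proof -
  have lin: "linear \<phi>" "linear \<gamma>" and norm: "norm (\<phi> v) = norm v" for v
    using \<phi> \<gamma> by (simp_all add: isometric_identification_def G2_def)
  have inj: "v = w" if "\<phi> v = \<phi> w" for v w
    using norm[of "v - w"] that by (simp add: linear_diff[OF lin(1)])
  show ?thesis
    by (intro linearI inj)
      (simp_all add: isometric_identification_V_act[OF \<phi> \<gamma>] linear_add[OF lin(1)]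
        linear_add[OF lin(2)] linear_scale[OF lin(1)] linear_scale[OF lin(2)])
qed

lemma orthonormal_basis_V_act:
  assumes \<phi>: "isometric_identification \<phi>" and \<gamma>: "\<gamma> \<in> G2" and e: "orthonormal_basis e"
  shows "orthonormal_basis (\<lambda>i. V_act \<phi> \<gamma> (e i))"
proof -
  let ?A = "V_act \<phi> \<gamma>"
  have A: "orthogonal_transformation ?A"
    using linear_V_act[OF \<phi> \<gamma>] norm_V_act[OF \<phi> \<gamma>] by (simp add: orthogonal_transformation)
  have "span (range (\<lambda>i. ?A (e i))) = ?A ` span (range e)"
    by (simp add: linear_span_image[OF linear_V_act[OF \<phi> \<gamma>], symmetric] image_image)
  also have "\<dots> = UNIV"
    using e orthogonal_transformation_surj[OF A] by (simp add: orthonormal_basis_def)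
  finally show ?thesis
    using e A by (simp add: orthonormal_basis_def orthogonal_transformation_def)
qed

section \<open>Equivariance\<close>

lemma bilinear_W_act:
  assumes "isometric_identification \<phi>" "\<gamma> \<in> G2"
  shows "bilinear (\<lambda>x v. \<gamma> x \<otimes>\<^sub>R V_act \<phi> \<gamma> v)"
proof -
  have lin: "linear \<gamma>" "linear (V_act \<phi> \<gamma>)"
    using assms linear_V_act by (simp_all add: G2_def)
  show ?thesis
    by (simp add: bilinear_def linear_iff linear_add[OF lin(1)] linear_add[OF lin(2)]
        linear_scale[OF lin(1)] linear_scale[OF lin(2)] tensor_bilinear_simps)
qed

lemma
  assumes "isometric_identification \<phi>" "\<gamma> \<in> G2"
  shows linear_W_act: "linear (W_act \<phi> \<gamma>)"
    and W_act_tensor: "W_act \<phi> \<gamma> (x \<otimes>\<^sub>R v) = \<gamma> x \<otimes>\<^sub>R V_act \<phi> \<gamma> v"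
  unfolding W_act_def using tensor_lift[OF bilinear_W_act[OF assms]] by blast+

lemma h_op_G2_equivariant:
  assumes \<phi>: "isometric_identification \<phi>" and e: "orthonormal_basis e"
  shows "equivariant G2 (W_act \<phi>) (h_op \<phi> e)"
  unfolding equivariant_def
proof
  fix \<gamma> assume \<gamma>: "\<gamma> \<in> G2"
  let ?f = "\<lambda>i. V_act \<phi> \<gamma> (e i)"
  have lin: "linear \<phi>"
    using \<phi> by (simp add: isometric_identification_def)
  have mult: "\<gamma> (x * y) = \<gamma> x * \<gamma> y" for x y
    using \<gamma> by (simp add: G2_def)
  note f = orthonormal_basis_V_act[OF \<phi> \<gamma> e]
  note act = linear_W_act[OF \<phi> \<gamma>] W_act_tensor[OF \<phi> \<gamma>] isometric_identification_V_act[OF \<phi> \<gamma>]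
  \<comment> \<open>The action naturally intertwines two coordinate forms of \<open>h\<close>: the given basis and its image.\<close>
  have "h_op \<phi> ?f \<circ> W_act \<phi> \<gamma> = W_act \<phi> \<gamma> \<circ> h_op \<phi> e"
  proof (rule tensor_lift_unique)
    show "linear (h_op \<phi> ?f \<circ> W_act \<phi> \<gamma>)" "linear (W_act \<phi> \<gamma> \<circ> h_op \<phi> e)"
      by (intro linear_compose act linear_h_op lin e f)+
    show "(h_op \<phi> ?f \<circ> W_act \<phi> \<gamma>) (x \<otimes>\<^sub>R v) = (W_act \<phi> \<gamma> \<circ> h_op \<phi> e) (x \<otimes>\<^sub>R v)" for x v
      by (simp add: h_op_tensor[OF lin e] h_op_tensor[OF lin f] linear_sum[OF act(1)]
          act(2,3) mult)
  qed
  then show "\<forall>w. h_op \<phi> e (W_act \<phi> \<gamma> w) = W_act \<phi> \<gamma> (h_op \<phi> e w)"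
    using h_op_basis_independent[OF lin e f] by (metis comp_apply)
qed

lemma R_op_stabilizer_equivariant:
  assumes \<phi>: "isometric_identification \<phi>"
  shows "equivariant (stabilizer \<phi> u) (W_act \<phi>) (R_op (\<phi> u))"
  unfolding equivariant_def
proof
  fix \<gamma> assume "\<gamma> \<in> stabilizer \<phi> u"
  then have \<gamma>: "\<gamma> \<in> G2" and u: "V_act \<phi> \<gamma> u = u"
    by (simp_all add: stabilizer_def)
  have mult: "\<gamma> (x * y) = \<gamma> x * \<gamma> y" for x y
    using \<gamma> by (simp add: G2_def)
  have fixed: "\<gamma> (\<phi> u) = \<phi> u"
    using isometric_identification_V_act[OF \<phi> \<gamma>, of u] u by simp
  have "R_op (\<phi> u) \<circ> W_act \<phi> \<gamma> = W_act \<phi> \<gamma> \<circ> R_op (\<phi> u)"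
  proof (rule tensor_lift_unique)
    show "linear (R_op (\<phi> u) \<circ> W_act \<phi> \<gamma>)" "linear (W_act \<phi> \<gamma> \<circ> R_op (\<phi> u))"
      by (intro linear_compose linear_W_act[OF \<phi> \<gamma>] linear_R_op)+
    show "(R_op (\<phi> u) \<circ> W_act \<phi> \<gamma>) (x \<otimes>\<^sub>R v) = (W_act \<phi> \<gamma> \<circ> R_op (\<phi> u)) (x \<otimes>\<^sub>R v)" for x v
      by (simp add: R_op W_act_tensor[OF \<phi> \<gamma>] mult fixed)
  qed
  then show "\<forall>w. R_op (\<phi> u) (W_act \<phi> \<gamma> w) = W_act \<phi> \<gamma> (R_op (\<phi> u) w)"
    by (metis comp_apply)
qed

theorem proposition5p4:
  fixes \<phi> :: "'v::euclidean_space \<Rightarrow> octo"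
    and e :: "7 \<Rightarrow> 'v"
    and u :: 'v
    and Q :: real
  assumes "DIM('v) = 7"
    and "isometric_identification \<phi>"
    and "orthonormal_basis e"
    and "norm u = 1"
  shows "equivariant (stabilizer \<phi> u) (W_act \<phi>) (H_op \<phi> e u Q)"
  unfolding equivariant_def
proof (intro ballI allI)
  fix \<gamma> w assume \<gamma>: "\<gamma> \<in> stabilizer \<phi> u"
  then have G2: "\<gamma> \<in> G2"
    by (simp add: stabilizer_def)
  note lin = linear_W_act[OF assms(2) G2]
  show "H_op \<phi> e u Q (W_act \<phi> \<gamma> w) = W_act \<phi> \<gamma> (H_op \<phi> e u Q w)"
    using h_op_G2_equivariant[OF assms(2,3)] R_op_stabilizer_equivariant[OF assms(2)] \<gamma> G2
    by (simp add: H_op_def equivariant_def linear_diff[OF lin] linear_scale[OF lin])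
qed

end
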